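(* Let $p_1,\dots,p_m$ be $p$-values in $[0,1]$ for null hypotheses $H_1,\dots,H_m$ with fixed truth statuses, and let $\alpha\in[0,1]$. If $p_1,\dots,p_m$ are independent and $p_i\sim\mathrm{Uniform}(0,1)$ whenever $H_i$ is true, then $$\mathrm{bFDR}(\mathcal R_\alpha)=\bar\pi_0\,\alpha,$$ where $\mathcal R_\alpha=\{i:\ p_i\le p_{(R_\alpha)}\}$ is the rejection set of the Support Line procedure at level $\alpha$.
   Context: Let $p_{(1)}\le\dots\le p_{(m)}$ be the order statistics of $p_1,\dots,p_m$ and $p_{(0)}:=0$. The Support Line (SL) procedure at level $\alpha$ rejects the $R_\alpha$ smallest $p$-values, where $$R_\alpha=\underset{k=0,\dots,m}{\operatorname{argmax}}\left\{\frac{\alpha k}{m}-p_{(k)}\right\}$$ (the largest maximizer in case of ties). $H_{(k)}$ denotes the null hypothesis corresponding to the $k$th smallest $p$-value, and by convention $H_{(0)}$ is false. The boundary false discovery rate of the procedure is $\mathrm{bFDR}(\mathcal R_\alpha)=\mathbb{P}(H_{(R_\alpha)}\text{ is true})$. $\bar\pi_0=m_0/m$ with $m_0=\#\{i:H_i\text{ is true}\}$. *)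

theory Defs
  imports "HOL-Probability.Probability"
begin

text \<open>Realized p-values are functions \<open>q :: nat \<Rightarrow> real\<close>, relevant on the indices \<open>{1..m}\<close>.\<close>

text \<open>\<open>sort_key\<close> is stable, so ties are broken by the smaller index.\<close>

definition order_index :: "nat \<Rightarrow> (nat \<Rightarrow> real) \<Rightarrow> nat \<Rightarrow> nat" where
  "order_index m q k = sort_key q [1..<Suc m] ! (k - 1)"

definition order_stat :: "nat \<Rightarrow> (nat \<Rightarrow> real) \<Rightarrow> nat \<Rightarrow> real" where
  "order_stat m q k = (if k = 0 then 0 else sort (map q [1..<Suc m]) ! (k - 1))"

definition sl_count :: "real \<Rightarrow> nat \<Rightarrow> (nat \<Rightarrow> real) \<Rightarrow> nat" where
  "sl_count \<alpha> m q =
     Max {k. is_arg_max (\<lambda>k. \<alpha> * real k / real m - order_stat m q k) (\<lambda>k. k \<le> m) k}"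

definition sl_rejections :: "real \<Rightarrow> nat \<Rightarrow> (nat \<Rightarrow> real) \<Rightarrow> nat set" where
  "sl_rejections \<alpha> m q = {i \<in> {1..m}. q i \<le> order_stat m q (sl_count \<alpha> m q)}"

text \<open>\<open>H i\<close> states that the \<open>i\<close>-th null hypothesis is true. By convention the ordered
  hypothesis at \<open>k = 0\<close> is false.\<close>

definition ordered_null :: "nat \<Rightarrow> (nat \<Rightarrow> bool) \<Rightarrow> (nat \<Rightarrow> real) \<Rightarrow> nat \<Rightarrow> bool" where
  "ordered_null m H q k \<longleftrightarrow> k \<noteq> 0 \<and> H (order_index m q k)"

text \<open>The procedure \<open>\<R>\<close> maps realized p-values to the rejection set; the boundary hypothesis is
  the \<open>R\<close>-th ordered one, with \<open>R\<close> the number of rejections. For the Support Line procedure that number is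
  \<open>sl_count\<close>, see \<open>card_sl_rejections\<close> and \<open>bFDR_sl_rejections\<close> below.\<close>

definition bFDR ::
  "'a measure \<Rightarrow> nat \<Rightarrow> (nat \<Rightarrow> bool) \<Rightarrow> (nat \<Rightarrow> 'a \<Rightarrow> real) \<Rightarrow> ((nat \<Rightarrow> real) \<Rightarrow> nat set) \<Rightarrow> real" where
  "bFDR M m H p \<R> =
     measure M {\<omega> \<in> space M. ordered_null m H (\<lambda>i. p i \<omega>) (card (\<R> (\<lambda>i. p i \<omega>)))}"

definition null_proportion :: "nat \<Rightarrow> (nat \<Rightarrow> bool) \<Rightarrow> real" where
  "null_proportion m H = real (card {i \<in> {1..m}. H i}) / real m"

lemma order_stat_eq_order_index:
  assumes "1 \<le> k" "k \<le> m"
  shows "order_stat m q k = q (order_index m q k)"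
proof -
  have "sort (map q [1..<Suc m]) = map q (sort_key q [1..<Suc m])"
    by (rule properties_for_sort) (simp_all del: upt_Suc)
  then show ?thesis
    using assms by (simp add: order_stat_def order_index_def del: upt_Suc)
qed

lemma sl_count_maximizer:
  fixes \<alpha> :: real and m :: nat and q :: "nat \<Rightarrow> real"
  defines "f \<equiv> \<lambda>k. \<alpha> * real k / real m - order_stat m q k"
  shows "sl_count \<alpha> m q \<le> m"
    and "\<And>k. k \<le> m \<Longrightarrow> f k \<le> f (sl_count \<alpha> m q)"
    and "\<And>k. k \<le> m \<Longrightarrow> sl_count \<alpha> m q < k \<Longrightarrow> f k < f (sl_count \<alpha> m q)"
proof -
  let ?S = "{k. is_arg_max f (\<lambda>k. k \<le> m) k}"
  have fin: "finite ?S"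
    by (rule finite_subset[of _ "{..m}"]) (auto simp: is_arg_max_def)
  have "Max (f ` {..m}) \<in> f ` {..m}"
    by (rule Max_in) auto
  then obtain k0 where k0: "k0 \<le> m" "f k0 = Max (f ` {..m})"
    by (metis atMost_iff imageE)
  have "f k \<le> f k0" if "k \<le> m" for k
    unfolding k0(2) using that by (intro Max_ge) auto
  then have "k0 \<in> ?S"
    using k0(1) by (auto simp: is_arg_max_linorder)
  then have R: "sl_count \<alpha> m q \<in> ?S"
    unfolding sl_count_def f_def[symmetric] using fin by (intro Max_in) auto
  show "sl_count \<alpha> m q \<le> m"
    using R by (simp add: is_arg_max_linorder)
  show le: "f k \<le> f (sl_count \<alpha> m q)" if "k \<le> m" for k
    using R that by (simp add: is_arg_max_linorder)
  show "f k < f (sl_count \<alpha> m q)" if k: "k \<le> m" "sl_count \<alpha> m q < k" for k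
  proof (rule ccontr)
    assume "\<not> f k < f (sl_count \<alpha> m q)"
    then have "f j \<le> f k" if "j \<le> m" for j
      using le[OF that] by linarith
    then have "k \<in> ?S"
      using k by (simp add: is_arg_max_linorder)
    then have "k \<le> sl_count \<alpha> m q"
      unfolding sl_count_def f_def[symmetric] using fin by (intro Max_ge) auto
    then show False using k by simp
  qed
qed

lemma card_sl_rejections:
  assumes "0 \<le> \<alpha>"
  shows "card (sl_rejections \<alpha> m q) = sl_count \<alpha> m q"
proof -
  let ?R = "sl_count \<alpha> m q"
  let ?c = "order_stat m q ?R"
  let ?xs = "sort (map q [1..<Suc m])"
  have len: "length ?xs = m" by simp
  have xs_nth: "?xs ! i \<le> ?c \<longleftrightarrow> i < ?R" if "i < m" for i
  proof (cases "i < ?R")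
    case True
    have "?xs ! i \<le> ?xs ! (?R - 1)"
      using True sl_count_maximizer(1)[of \<alpha> m q] len
      by (intro sorted_nth_mono) (auto simp del: upt_Suc)
    then show ?thesis using True by (simp add: order_stat_def del: upt_Suc)
  next
    case False
    then have "\<alpha> * real (Suc i) / real m - order_stat m q (Suc i) < \<alpha> * real ?R / real m - ?c"
      using that by (intro sl_count_maximizer(3)) auto
    moreover have "\<alpha> * real ?R / real m \<le> \<alpha> * real (Suc i) / real m"
      using assms False by (intro divide_right_mono mult_left_mono) auto
    ultimately have "?c < order_stat m q (Suc i)" by linarith
    then show ?thesis using False by (simp add: order_stat_def del: upt_Suc)
  qed
  have "card (sl_rejections \<alpha> m q) = card (set (filter (\<lambda>i. q i \<le> ?c) [1..<Suc m]))"
    by (rule arg_cong[where f = card]) (auto simp: sl_rejections_def simp del: upt_Suc)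
  also have "\<dots> = length (filter (\<lambda>i. q i \<le> ?c) [1..<Suc m])"
    by (rule distinct_card) (simp del: upt_Suc)
  also have "\<dots> = length (filter (\<lambda>x. x \<le> ?c) (map q [1..<Suc m]))"
    by (simp add: filter_map comp_def del: upt_Suc)
  also have "\<dots> = size (filter_mset (\<lambda>x. x \<le> ?c) (mset (map q [1..<Suc m])))"
    by (metis mset_filter size_mset)
  also have "\<dots> = length (filter (\<lambda>x. x \<le> ?c) ?xs)"
    by (metis mset_filter size_mset mset_sort)
  also have "\<dots> = card {i. i < m \<and> ?xs ! i \<le> ?c}"
    by (simp only: length_filter_conv_card len)
  also have "{i. i < m \<and> ?xs ! i \<le> ?c} = {..<?R}"
    using xs_nth sl_count_maximizer(1)[of \<alpha> m q] by (auto simp del: upt_Suc)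
  finally show ?thesis by simp
qed

lemma bFDR_sl_rejections:
  assumes "0 \<le> \<alpha>"
  shows "bFDR M m H p (sl_rejections \<alpha> m) =
    measure M {\<omega> \<in> space M. ordered_null m H (\<lambda>i. p i \<omega>) (sl_count \<alpha> m (\<lambda>i. p i \<omega>))}"
  by (simp add: bFDR_def card_sl_rejections[OF assms])

end

theory Submission
  imports Defs
begin

text \<open>
  Exactly one index has a given rank, so the boundary hypothesis is true iff some true null \<open>i\<close> has
  rank \<open>R\<^sub>\<alpha>\<close>, and these events are disjoint. It therefore suffices that each true null is the
  boundary hypothesis with probability \<open>\<delta> = \<alpha> / m\<close>. This even holds conditionally on all other
  p-values (\<open>boundary_section_measure\<close>), and independence turns the conditional statement into the
  unconditional one by Fubini (\<open>prob_null_at_boundary\<close>).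

  Now freeze the other p-values, let \<open>N s\<close> count those that are at most \<open>s\<close>, and put
  \<open>G s = \<delta> * N s - s\<close>. Placing \<open>p\<^sub>i\<close> at \<open>t\<close> raises \<open>G\<close> by \<open>\<delta>\<close> on \<open>[t, \<infinity>)\<close>, and ties aside,
  \<open>i\<close> is at the boundary iff \<open>t\<close> is the last maximizer on \<open>[0, \<infinity>)\<close> of the raised function
  (\<open>stable_rank_eq_sl_count_iff\<close>). Equivalently, \<open>t\<close> is a right-to-left record of \<open>G\<close>, meaning that
  \<open>G s < G t\<close> for every \<open>s > t\<close>, whose height is within \<open>\<delta>\<close> of \<open>c = sup G\<close>.

  The function \<open>G\<close> moves downwards only along segments of slope \<open>-1\<close>, so scanning from the right it
  meets every height below \<open>c\<close> at exactly one record. Hence \<open>G\<close> maps the records with heights in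
  \<open>(c - \<delta>, c)\<close> bijectively onto that interval. On the records with a fixed count \<open>N t\<close> the map is a
  reflection, which preserves length, so the set of admissible \<open>t\<close> has length exactly \<open>\<delta>\<close>
  (\<open>record_set_measure\<close>), whatever the other p-values are. The bound \<open>\<alpha> \<le> 1\<close> guarantees that this
  set lies in \<open>[0, 1]\<close>, where \<open>p\<^sub>i\<close> is uniform.
\<close>

section \<open>The measure of a set of right-to-left records\<close>

lemma emeasure_lborel_reflection:
  fixes a :: real
  assumes "X \<in> sets borel"
  shows "emeasure lborel ((\<lambda>t. a - t) -` X) = emeasure lborel X"
proof -
  have "lborel = distr lborel borel (\<lambda>t. a - t)"
    using lborel_real_affine[of "-1" a] by (simp add: density_1 flip: one_ennreal_def)
  then have "emeasure lborel X = emeasure (distr lborel borel (\<lambda>t. a - t)) X"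
    by simp
  also have "\<dots> = emeasure lborel ((\<lambda>t. a - t) -` X)"
    using assms by (subst emeasure_distr) auto
  finally show ?thesis by simp
qed

text \<open>
  The record of height \<open>x\<close> can be found by a finite search over counts: if \<open>\<kappa> x\<close> is the largest \<open>k\<close>
  with \<open>k \<le> N (\<delta> * k - x)\<close>, the record is \<open>\<delta> * \<kappa> x - x\<close>, its count being \<open>\<kappa> x\<close>. Monotonicity
  of \<open>N\<close> makes the relaxed search condition sharp at its largest solution, and boundedness makes the
  search finite. The set \<open>A\<close> is cut into the pieces of constant count, each the reflection of a piece of
  \<open>G ` A\<close> on which \<open>\<kappa>\<close> is constant.
\<close>

lemma record_set_measure:
  fixes N :: "real \<Rightarrow> nat" and n :: nat and \<delta> :: real
  assumes mono: "mono N" and bound: "\<And>s. N s \<le> n" and \<delta>: "0 \<le> \<delta>"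
  defines "G \<equiv> \<lambda>s. \<delta> * real (N s) - s"
  defines "A \<equiv> {t. 0 \<le> t \<and> (\<forall>s\<ge>0. s < t \<longrightarrow> G s \<le> G t + \<delta>) \<and> (\<forall>s>t. G s < G t)}"
  shows "A \<in> sets borel" and "emeasure lborel A = ennreal \<delta>"
proof -
  define S where "S x = {k. k \<le> n \<and> k \<le> N (\<delta> * real k - x)}" for x
  define \<kappa> where "\<kappa> x = Max (S x)" for x
  \<comment> \<open>A point \<open>s\<close> with count \<open>k\<close> has height \<open>x\<close> iff \<open>s = \<delta> * k - x\<close>, so \<open>S x\<close> relaxes the condition
    that \<open>k\<close> is the count of a point of height \<open>x\<close>.\<close>
  have S_finite: "finite (S x)" and S_zero: "0 \<in> S x" for x
    by (auto simp: S_def)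
  have \<kappa>_in: "\<kappa> x \<in> S x" for x
    unfolding \<kappa>_def using S_finite S_zero by (intro Max_in) blast+
  have \<kappa>_ge: "k \<le> \<kappa> x" if "k \<in> S x" for k x
    unfolding \<kappa>_def using S_finite that by (rule Max_ge)
  have \<kappa>_antimono: "\<kappa> y \<le> \<kappa> x" if "x \<le> y" for x y
  proof -
    have "N (\<delta> * real (\<kappa> y) - y) \<le> N (\<delta> * real (\<kappa> y) - x)"
      using that by (intro monoD[OF mono]) simp
    then show ?thesis
      using \<kappa>_in[of y] by (intro \<kappa>_ge) (auto simp: S_def)
  qed
  have \<kappa>_G: "\<kappa> (G t) = N t" if "t \<in> A" for t
  proof (rule antisym)
    show "N t \<le> \<kappa> (G t)"
      using bound by (intro \<kappa>_ge) (simp add: S_def G_def)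
    show "\<kappa> (G t) \<le> N t"
    proof (rule ccontr)
      define s where "s = \<delta> * real (\<kappa> (G t)) - G t"
      assume *: "\<not> \<kappa> (G t) \<le> N t"
      have Ns: "\<kappa> (G t) \<le> N s"
        using \<kappa>_in[of "G t"] by (simp add: S_def s_def)
      have "t < s"
        using * Ns monoD[OF mono, of s t] by linarith
      then have "G s < G t"
        using that by (simp add: A_def)
      moreover have "\<delta> * real (\<kappa> (G t)) \<le> \<delta> * real (N s)"
        using Ns \<delta> by (intro mult_left_mono) auto
      ultimately show False
        by (simp add: G_def s_def)
    qed
  qed

  define c where "c = Sup (G ` {0..})"
  have G_bdd: "bdd_above (G ` {0..})"
  proof (rule bdd_aboveI2)
    fix s :: real assume "s \<in> {0..}"
    moreover have "\<delta> * real (N s) \<le> \<delta> * real n"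
      using \<delta> bound by (intro mult_left_mono) auto
    ultimately show "G s \<le> \<delta> * real n"
      by (simp add: G_def)
  qed
  have G_le: "G s \<le> c" if "0 \<le> s" for s
    unfolding c_def using that G_bdd by (intro cSup_upper) auto
  have G_lower: "c \<le> G t + \<delta>" if "t \<in> A" for t
    unfolding c_def
  proof (rule cSup_least)
    fix x assume "x \<in> G ` {0..}"
    then obtain s where s: "0 \<le> s" "x = G s" by auto
    consider "s < t" | "s = t" | "t < s" by linarith
    then show "x \<le> G t + \<delta>"
      using s that \<delta> by cases (auto simp: A_def intro: order.trans less_imp_le)
  qed simp

  have surj: "x \<in> G ` A" if x: "c - \<delta> < x" "x < c" for x
  proof -
    define t where "t = \<delta> * real (\<kappa> x) - x"
    obtain s where s: "0 \<le> s" "x < G s"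
      using x(2) less_cSup_iff[OF _ G_bdd, of x] by (auto simp: c_def)
    \<comment> \<open>Every point with \<open>G\<close> at least \<open>x\<close> lies at or before \<open>t\<close>, because its count is a
      candidate for \<open>\<kappa> x\<close>.\<close>
    have up: "r \<le> t" if r: "x \<le> G r" for r
    proof -
      have "N r \<le> N (\<delta> * real (N r) - x)"
        using r by (intro monoD[OF mono]) (simp add: G_def)
      then have "N r \<le> \<kappa> x"
        using bound by (intro \<kappa>_ge) (simp add: S_def)
      then have "\<delta> * real (N r) \<le> \<delta> * real (\<kappa> x)"
        using \<delta> by (intro mult_left_mono) auto
      then show ?thesis
        using r by (simp add: G_def t_def)
    qed
    have t0: "0 \<le> t"
      using up[of s] s by simp
    \<comment> \<open>The height of \<open>t\<close> is at least \<open>x\<close>, so its own count is again a candidate for \<open>\<kappa> x\<close>. By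
      maximality the two counts agree, and the height is exactly \<open>x\<close>.\<close>
    have "\<kappa> x \<le> N t"
      using \<kappa>_in[of x] by (simp add: S_def t_def)
    then have "\<delta> * real (\<kappa> x) \<le> \<delta> * real (N t)"
      using \<delta> by (intro mult_left_mono) auto
    then have Gt_ge: "x \<le> G t"
      by (simp add: G_def t_def)
    have "N t \<le> N (\<delta> * real (N t) - x)"
      using Gt_ge by (intro monoD[OF mono]) (simp add: G_def)
    then have "N t \<le> \<kappa> x"
      using bound by (intro \<kappa>_ge) (simp add: S_def)
    with \<open>\<kappa> x \<le> N t\<close> have Gt: "G t = x"
      by (simp add: G_def t_def)
    have "G s \<le> G t + \<delta>" if "0 \<le> s" for s
      using G_le[OF that] x(1) Gt by linarith
    moreover have "G s < G t" if "t < s" for s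
      using up[of s] that Gt by linarith
    ultimately have "t \<in> A"
      using t0 by (simp add: A_def)
    then show ?thesis
      using Gt by blast
  qed

  define X where "X = G ` A"
  have X_sub: "X \<subseteq> {c - \<delta>..c}"
  proof
    fix x assume "x \<in> X"
    then obtain t where t: "t \<in> A" "x = G t" by (auto simp: X_def)
    then have "0 \<le> t" by (simp add: A_def)
    then show "x \<in> {c - \<delta>..c}"
      using G_le[of t] G_lower[OF t(1)] t(2) by simp
  qed
  have X_sup: "{c - \<delta><..<c} \<subseteq> X"
    using surj by (auto simp: X_def)
  have "X = {c - \<delta><..<c} \<union> (X \<inter> {c - \<delta>, c})"
    using X_sub X_sup by auto
  moreover have "X \<inter> {c - \<delta>, c} \<in> sets borel"
    by (intro borel_closed finite_imp_closed) simp
  ultimately have X_borel: "X \<in> sets borel"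
    by (metis borel_open open_greaterThanLessThan sets.Un)
  have X_measure: "emeasure lborel X = ennreal \<delta>"
  proof (rule antisym)
    show "emeasure lborel X \<le> ennreal \<delta>"
      using emeasure_mono[OF X_sub, of lborel] \<delta> by simp
    show "ennreal \<delta> \<le> emeasure lborel X"
      using emeasure_mono[OF X_sup, of lborel] X_borel \<delta> by simp
  qed

  define Ak where "Ak k = {t \<in> A. N t = k}" for k
  define Xk where "Xk k = {x \<in> X. \<kappa> x = k}" for k
  have "(\<lambda>x. real (\<kappa> x)) \<in> borel_measurable borel"
  proof -
    have "mono (\<lambda>x. - real (\<kappa> x))"
      using \<kappa>_antimono by (auto intro!: monoI)
    from borel_measurable_uminus[OF borel_measurable_mono[OF this]] show ?thesis
      by simp
  qed
  then have "{x \<in> space borel. real (\<kappa> x) = real k} \<in> sets borel" for k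
    by measurable
  then have Xk_borel: "Xk k \<in> sets borel" for k
    using sets.Int[OF X_borel, of "{x. \<kappa> x = k}"] by (simp add: Xk_def Int_def)
  have Ak_eq: "Ak k = (\<lambda>t. \<delta> * real k - t) -` Xk k" for k
  proof (intro set_eqI iffI)
    fix t assume "t \<in> Ak k"
    then have "t \<in> A" "\<delta> * real k - t = G t" "N t = k"
      by (auto simp: Ak_def G_def)
    then show "t \<in> (\<lambda>t. \<delta> * real k - t) -` Xk k"
      using \<kappa>_G by (auto simp: Xk_def X_def)
  next
    fix t assume "t \<in> (\<lambda>t. \<delta> * real k - t) -` Xk k"
    then obtain r where r: "r \<in> A" "\<delta> * real k - t = G r" "\<kappa> (G r) = k"
      by (auto simp: Xk_def X_def)
    then have "N r = k" using \<kappa>_G by simp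
    then have "r = t" using r(2) by (simp add: G_def)
    then show "t \<in> Ak k"
      using r \<open>N r = k\<close> by (simp add: Ak_def)
  qed
  have Ak_borel: "Ak k \<in> sets borel" for k
  proof -
    have "(\<lambda>t. \<delta> * real k - t) \<in> borel_measurable borel" by measurable
    from measurable_sets[OF this Xk_borel] show ?thesis
      by (simp add: Ak_eq)
  qed
  have A_Union: "A = (\<Union>k\<in>{..n}. Ak k)"
    using bound by (auto simp: Ak_def)
  show "A \<in> sets borel"
    unfolding A_Union using Ak_borel by (intro sets.finite_UN) auto
  have X_Union: "X = (\<Union>k\<in>{..n}. Xk k)"
    using \<kappa>_in by (auto simp: Xk_def S_def)
  have "emeasure lborel A = (\<Sum>k\<le>n. emeasure lborel (Ak k))"
    unfolding A_Union using Ak_borel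
    by (intro sum_emeasure[symmetric]) (auto simp: disjoint_family_on_def Ak_def)
  also have "\<dots> = (\<Sum>k\<le>n. emeasure lborel (Xk k))"
    by (simp add: Ak_eq emeasure_lborel_reflection Xk_borel)
  also have "\<dots> = emeasure lborel X"
    unfolding X_Union using Xk_borel
    by (intro sum_emeasure) (auto simp: disjoint_family_on_def Xk_def)
  finally show "emeasure lborel A = ennreal \<delta>"
    using X_measure by simp
qed

section \<open>Ranks and order statistics\<close>

text \<open>
  The inverse of \<open>order_index\<close>. Unlike the sorted list, it is a count of comparisons between
  p-values, which makes its measurability immediate and its relation to counting functions direct.
\<close>

definition stable_rank :: "nat \<Rightarrow> (nat \<Rightarrow> real) \<Rightarrow> nat \<Rightarrow> nat" where
  "stable_rank m q i = card {j \<in> {1..m}. q j < q i \<or> (q j = q i \<and> j \<le> i)}"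

definition count_upto :: "nat \<Rightarrow> (nat \<Rightarrow> real) \<Rightarrow> real \<Rightarrow> nat" where
  "count_upto m q s = card {j \<in> {1..m}. q j \<le> s}"

text \<open>
  Inserting \<open>x\<close> puts it in front of all entries with the same key; that is the right place as long as
  the entries already present are larger than \<open>x\<close>.
\<close>

lemma sorted_wrt_insort_key_stable:
  fixes q :: "'b::linorder \<Rightarrow> 'c::linorder"
  assumes "sorted_wrt (\<lambda>a b. q a < q b \<or> (q a = q b \<and> a < b)) xs" "\<forall>y\<in>set xs. x < y"
  shows "sorted_wrt (\<lambda>a b. q a < q b \<or> (q a = q b \<and> a < b)) (insort_key q x xs)"
  using assms by (induction xs) (auto simp: set_insort_key)

lemma sorted_wrt_sort_key_stable:
  fixes q :: "'b::linorder \<Rightarrow> 'c::linorder"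
  assumes "sorted_wrt (<) xs"
  shows "sorted_wrt (\<lambda>a b. q a < q b \<or> (q a = q b \<and> a < b)) (sort_key q xs)"
  using assms by (induction xs) (auto intro!: sorted_wrt_insort_key_stable)

lemma order_index_range:
  assumes "1 \<le> k" "k \<le> m"
  shows "order_index m q k \<in> {1..m}"
proof -
  have "sort_key q [1..<Suc m] ! (k - 1) \<in> set (sort_key q [1..<Suc m])"
    using assms by (intro nth_mem) (simp del: upt_Suc)
  then show ?thesis
    unfolding order_index_def by (simp del: upt_Suc)
qed

text \<open>
  The sorted index list is strictly increasing for the order by p-value and then by index, so the
  indices preceding or equal to its \<open>k\<close>-th entry are its first \<open>k\<close> entries.
\<close>

lemma stable_rank_order_index:
  assumes "1 \<le> k" "k \<le> m"
  shows "stable_rank m q (order_index m q k) = k"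
proof -
  define L where "L = sort_key q [1..<Suc m]"
  let ?R = "\<lambda>a b. q a < q b \<or> (q a = q b \<and> a < b)"
  have sorted: "sorted_wrt ?R L"
    unfolding L_def by (intro sorted_wrt_sort_key_stable) (simp del: upt_Suc)
  have L: "length L = m" "set L = {1..m}" "distinct L"
    by (auto simp: L_def simp del: upt_Suc)
  have less: "?R (L ! a) (L ! b)" if "a < b" "b < m" for a b
    using sorted_wrt_nth_less[OF sorted, of a b] that L by simp
  define i where "i = L ! (k - 1)"
  have "{j \<in> {1..m}. q j < q i \<or> (q j = q i \<and> j \<le> i)} = (!) L ` {..<k}"
  proof (intro set_eqI iffI)
    fix j assume "j \<in> (!) L ` {..<k}"
    then obtain a where a: "a < k" "j = L ! a" by auto
    then have "j \<in> {1..m}"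
      using L assms nth_mem[of a L] by simp
    moreover have "?R j i \<or> j = i"
      using a less[of a "k - 1"] assms by (cases "a = k - 1") (auto simp: i_def)
    ultimately show "j \<in> {j \<in> {1..m}. q j < q i \<or> (q j = q i \<and> j \<le> i)}"
      by auto
  next
    fix j assume j: "j \<in> {j \<in> {1..m}. q j < q i \<or> (q j = q i \<and> j \<le> i)}"
    then obtain a where a: "a < m" "j = L ! a"
      using L by (metis (no_types, lifting) in_set_conv_nth mem_Collect_eq)
    have "a < k"
    proof (rule ccontr)
      assume "\<not> a < k"
      then have "?R i j"
        using a less[of "k - 1" a] assms by (simp add: i_def)
      then show False using j by auto
    qed
    then show "j \<in> (!) L ` {..<k}" using a by auto
  qed
  moreover have "inj_on ((!) L) {..<k}"
    using L assms by (intro inj_on_nth) auto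
  ultimately have "stable_rank m q i = k"
    unfolding stable_rank_def by (simp only: card_image card_lessThan)
  then show ?thesis
    by (simp only: order_index_def flip: L_def i_def)
qed

lemma stable_rank_bounds:
  assumes "i \<in> {1..m}"
  shows "1 \<le> stable_rank m q i" "stable_rank m q i \<le> m"
proof -
  let ?B = "{j \<in> {1..m}. q j < q i \<or> (q j = q i \<and> j \<le> i)}"
  have "card {i} \<le> card ?B" "card ?B \<le> card {1..m}"
    using assms by (intro card_mono; auto)+
  then show "1 \<le> stable_rank m q i" "stable_rank m q i \<le> m"
    by (simp_all add: stable_rank_def)
qed

lemma order_index_eq_iff:
  assumes "i \<in> {1..m}" "1 \<le> k" "k \<le> m"
  shows "order_index m q k = i \<longleftrightarrow> stable_rank m q i = k"
proof
  assume "order_index m q k = i"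
  then show "stable_rank m q i = k"
    using stable_rank_order_index[OF assms(2,3)] by blast
next
  assume k: "stable_rank m q i = k"
  \<comment> \<open>\<open>order_index\<close> is injective on \<open>{1..m}\<close>, hence onto, so \<open>i\<close> has some position, which must
    be its rank.\<close>
  have "inj_on (order_index m q) {1..m}"
    using stable_rank_order_index by (intro inj_on_inverseI[where g = "stable_rank m q"]) auto
  moreover have "order_index m q ` {1..m} \<subseteq> {1..m}"
    using order_index_range by force
  ultimately have "order_index m q ` {1..m} = {1..m}"
    by (intro endo_inj_surj) auto
  then obtain l where "l \<in> {1..m}" "order_index m q l = i"
    using assms(1) by (metis imageE)
  then show "order_index m q k = i"
    using stable_rank_order_index[of l m q] k by auto
qed

text \<open>
  This Galois connection replaces all further reasoning about sorted lists: order statistics enter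
  the support line only through counts of p-values.
\<close>

lemma order_stat_le_iff:
  assumes "1 \<le> k" "k \<le> m"
  shows "order_stat m q k \<le> s \<longleftrightarrow> k \<le> count_upto m q s"
proof -
  define i where "i = order_index m q k"
  let ?B = "{j \<in> {1..m}. q j < q i \<or> (q j = q i \<and> j \<le> i)}"
  have i: "i \<in> {1..m}" and k: "card ?B = k"
    using order_index_range[OF assms, of q] stable_rank_order_index[OF assms, of q]
    by (simp_all add: i_def stable_rank_def)
  have "q i \<le> s \<longleftrightarrow> k \<le> card {j \<in> {1..m}. q j \<le> s}"
  proof
    assume "q i \<le> s"
    then show "k \<le> card {j \<in> {1..m}. q j \<le> s}"
      unfolding k[symmetric] by (intro card_mono) auto
  next
    assume le: "k \<le> card {j \<in> {1..m}. q j \<le> s}"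
    show "q i \<le> s"
    proof (rule ccontr)
      assume "\<not> q i \<le> s"
      then have "{j \<in> {1..m}. q j \<le> s} \<subset> ?B"
        using i by auto
      then have "card {j \<in> {1..m}. q j \<le> s} < k"
        unfolding k[symmetric] by (intro psubset_card_mono) auto
      with le show False by simp
    qed
  qed
  then show ?thesis
    using order_stat_eq_order_index[OF assms, of q] by (simp add: i_def count_upto_def)
qed

section \<open>The support line in terms of counts\<close>

lemma sl_count_eq_iff:
  assumes "k \<le> m"
  shows "sl_count \<alpha> m q = k \<longleftrightarrow>
    (\<forall>j\<in>{..m}. \<alpha> * real j / real m - order_stat m q j \<le> \<alpha> * real k / real m - order_stat m q k) \<and>
    (\<forall>j\<in>{k<..m}. \<alpha> * real j / real m - order_stat m q j < \<alpha> * real k / real m - order_stat m q k)"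
    (is "?L \<longleftrightarrow> ?R")
proof
  assume ?L
  then show ?R
    using sl_count_maximizer[where \<alpha> = \<alpha> and m = m and q = q] by auto
next
  assume R: ?R
  let ?c = "sl_count \<alpha> m q"
  show ?L
  proof (rule linorder_cases[of ?c k])
    assume "?c < k"
    then show ?L
      using sl_count_maximizer(3)[where k = k and m = m and \<alpha> = \<alpha> and q = q] R sl_count_maximizer(1)[of \<alpha> m q] assms
      by (auto dest!: bspec[of "{..m}" _ ?c])
  next
    assume "k < ?c"
    then show ?L
      using sl_count_maximizer(2)[where k = k and m = m and \<alpha> = \<alpha> and q = q] R sl_count_maximizer(1)[of \<alpha> m q] assms
      by (auto dest!: bspec[of "{k<..m}" _ ?c])
  qed
qed

text \<open>
  The objective at rank \<open>k\<close> is at most \<open>\<Phi>\<close> at the \<open>k\<close>-th order statistic, since at least \<open>k\<close>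
  p-values lie there or below; conversely \<open>\<Phi> s\<close> is at most the objective at rank
  \<open>count_upto m q s\<close>. So maximizing over ranks amounts to maximizing \<open>\<Phi>\<close> over all \<open>s \<ge> 0\<close>, and the
  largest maximizing rank corresponds to the last maximizing point. The absence of ties at \<open>q i\<close>
  makes the rank of \<open>i\<close> equal to the count at \<open>q i\<close>. Nonnegativity of the p-values keeps the order
  statistics in the range of \<open>s\<close>, consistently with the value \<open>0\<close> at rank \<open>0\<close>.
\<close>

lemma stable_rank_eq_sl_count_iff:
  fixes \<alpha> :: real and m :: nat and q :: "nat \<Rightarrow> real"
  assumes \<alpha>: "0 \<le> \<alpha>" and i: "i \<in> {1..m}"
    and nonneg: "\<And>j. j \<in> {1..m} \<Longrightarrow> 0 \<le> q j"
    and no_tie: "\<And>j. j \<in> {1..m} \<Longrightarrow> j \<noteq> i \<Longrightarrow> q j \<noteq> q i"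
  defines "\<Phi> \<equiv> \<lambda>s. \<alpha> * real (count_upto m q s) / real m - s"
  shows "stable_rank m q i = sl_count \<alpha> m q \<longleftrightarrow>
    (\<forall>s\<ge>0. \<Phi> s \<le> \<Phi> (q i)) \<and> (\<forall>s>q i. \<Phi> s < \<Phi> (q i))"
proof -
  define f where "f = (\<lambda>k. \<alpha> * real k / real m - order_stat m q k)"
  define K where "K = stable_rank m q i"
  have K: "1 \<le> K" "K \<le> m"
    using stable_rank_bounds[OF i] by (auto simp: K_def)
  have count_K: "count_upto m q (q i) = K"
    unfolding K_def stable_rank_def count_upto_def
    by (rule arg_cong[where f = card]) (use no_tie in force)
  have "order_index m q K = i"
    using order_index_eq_iff[OF i K] by (simp add: K_def)
  then have stat_K: "order_stat m q K = q i"
    using order_stat_eq_order_index[OF K, of q] by simp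
  then have f_K: "f K = \<Phi> (q i)"
    by (simp add: f_def \<Phi>_def count_K)
  have count_le: "count_upto m q s \<le> m" for s
  proof -
    have "count_upto m q s \<le> card {1..m}"
      unfolding count_upto_def by (intro card_mono) auto
    then show ?thesis by simp
  qed
  have scale_mono: "\<alpha> * real a / real m \<le> \<alpha> * real b / real m" if "a \<le> b" for a b
    using that \<alpha> by (intro divide_right_mono mult_left_mono) auto
  have stat_nonneg: "0 \<le> order_stat m q k" if "k \<le> m" for k
  proof (cases "k = 0")
    case False
    then have "1 \<le> k" by simp
    then show ?thesis
      using order_stat_eq_order_index[OF _ that, of q] order_index_range[OF _ that, of q] nonneg
      by simp
  qed (simp add: order_stat_def)
  have f_le: "f k \<le> \<Phi> (order_stat m q k)" if "k \<le> m" for k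
  proof -
    have "k \<le> count_upto m q (order_stat m q k)"
      using order_stat_le_iff[of k m q "order_stat m q k"] that by (cases "k = 0") auto
    from scale_mono[OF this] show ?thesis
      by (simp add: f_def \<Phi>_def)
  qed
  have \<Phi>_le: "\<Phi> s \<le> f (count_upto m q s)" if "0 \<le> s" for s
  proof -
    have "order_stat m q (count_upto m q s) \<le> s"
      using order_stat_le_iff[of "count_upto m q s" m q s] count_le that
      by (cases "count_upto m q s = 0") (auto simp: order_stat_def)
    then show ?thesis
      by (simp add: f_def \<Phi>_def)
  qed
  have sl: "K = sl_count \<alpha> m q \<longleftrightarrow> (\<forall>j\<in>{..m}. f j \<le> f K) \<and> (\<forall>j\<in>{K<..m}. f j < f K)"
    using sl_count_eq_iff[OF K(2), of \<alpha> q] by (auto simp: f_def)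
  show ?thesis
    unfolding K_def[symmetric] sl
  proof (intro iffI conjI allI ballI impI)
    assume R: "(\<forall>s\<ge>0. \<Phi> s \<le> \<Phi> (q i)) \<and> (\<forall>s>q i. \<Phi> s < \<Phi> (q i))"
    show "f j \<le> f K" if "j \<in> {..m}" for j
      using R f_le[of j] stat_nonneg[of j] that by (force simp: f_K intro: order.trans)
    show "f j < f K" if "j \<in> {K<..m}" for j
    proof -
      have "\<not> order_stat m q j \<le> q i"
        using order_stat_le_iff[of j m q "q i"] that count_K by auto
      then have "\<Phi> (order_stat m q j) < f K"
        using R f_K by auto
      then show ?thesis
        using f_le[of j] that by simp
    qed
  next
    assume L: "(\<forall>j\<in>{..m}. f j \<le> f K) \<and> (\<forall>j\<in>{K<..m}. f j < f K)"
    show "\<Phi> s \<le> \<Phi> (q i)" if "0 \<le> s" for s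
      using \<Phi>_le[OF that] L count_le[of s] f_K by (auto intro: order.trans)
    show "\<Phi> s < \<Phi> (q i)" if "q i < s" for s
    proof (cases "count_upto m q s = K")
      case True
      then show ?thesis
        using that count_K by (simp add: \<Phi>_def)
    next
      case False
      have "count_upto m q (q i) \<le> count_upto m q s"
        unfolding count_upto_def using that by (intro card_mono) auto
      then have "f (count_upto m q s) < f K"
        using False L count_K count_le[of s] by auto
      then show ?thesis
        using \<Phi>_le[of s] that nonneg[OF i] f_K by simp
    qed
  qed
qed

section \<open>Varying a single p-value\<close>

text \<open>
  With the other p-values fixed, \<open>\<Phi>\<close> equals \<open>G\<close> to the left of \<open>t\<close> and \<open>G + \<delta>\<close> from \<open>t\<close> on, so the
  maximizer conditions on \<open>\<Phi>\<close> become the record conditions on \<open>G\<close>. The finitely many values \<open>t\<close>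
  that create a tie form a null set.
\<close>

lemma boundary_section_measure:
  fixes \<alpha> :: real and m :: nat and q :: "nat \<Rightarrow> real"
  assumes \<alpha>: "\<alpha> \<in> {0..1}" and i: "i \<in> {1..m}"
    and nonneg: "\<And>j. j \<in> {1..m} - {i} \<Longrightarrow> 0 \<le> q j"
  defines "B \<equiv> {t. stable_rank m (q(i := t)) i = sl_count \<alpha> m (q(i := t))}"
  assumes B: "B \<in> sets borel"
  shows "emeasure lborel ({0..1} \<inter> B) = ennreal (\<alpha> / real m)"
proof -
  define \<delta> where "\<delta> = \<alpha> / real m"
  define N where "N s = card {j \<in> {1..m} - {i}. q j \<le> s}" for s
  define G where "G = (\<lambda>s. \<delta> * real (N s) - s)"
  define A where
    "A = {t. 0 \<le> t \<and> (\<forall>s\<ge>0. s < t \<longrightarrow> G s \<le> G t + \<delta>) \<and> (\<forall>s>t. G s < G t)}"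
  have m: "0 < m" using i by simp
  have \<delta>: "0 \<le> \<delta>" using \<alpha> by (simp add: \<delta>_def)
  have N_mono: "mono N"
    unfolding N_def by (intro monoI card_mono) auto
  have N_bound: "N s \<le> m - 1" for s
  proof -
    have "N s \<le> card ({1..m} - {i})"
      unfolding N_def by (intro card_mono) auto
    then show ?thesis using i by simp
  qed
  have A_measure: "A \<in> sets borel" "emeasure lborel A = ennreal \<delta>"
    unfolding A_def G_def by (rule record_set_measure[OF N_mono N_bound \<delta>])+
  \<comment> \<open>Comparing the height at \<open>t\<close> with the one at \<open>0\<close> gives \<open>t \<le> \<delta> * (N t + 1) \<le> \<delta> * m = \<alpha>\<close>.\<close>
  have A_le: "t \<le> 1" if "t \<in> A" for t
  proof -
    have "G 0 \<le> G t + \<delta>"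
      using that \<delta> by (cases "t = 0") (auto simp: A_def)
    moreover have "0 \<le> G 0"
      using \<delta> by (simp add: G_def)
    ultimately have "t \<le> \<delta> * (real (N t) + 1)"
      by (simp add: G_def algebra_simps)
    also have "\<dots> \<le> \<delta> * real m"
      using \<delta> N_bound[of t] m by (intro mult_left_mono) auto
    also have "\<dots> \<le> 1"
      using \<alpha> m by (simp add: \<delta>_def)
    finally show ?thesis .
  qed
  have B_iff: "t \<in> B \<longleftrightarrow> t \<in> A" if t: "0 \<le> t" "t \<notin> q ` {1..m}" for t
  proof -
    define x where "x = q(i := t)"
    define \<Phi> where "\<Phi> = (\<lambda>s. \<alpha> * real (count_upto m x s) / real m - s)"
    have count: "count_upto m x s = N s + (if t \<le> s then 1 else 0)" for s
    proof -
      have "{j \<in> {1..m}. x j \<le> s} =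
          {j \<in> {1..m} - {i}. q j \<le> s} \<union> (if t \<le> s then {i} else {})"
        using i by (auto simp: x_def)
      then show ?thesis
        by (simp add: count_upto_def N_def)
    qed
    have \<Phi>: "\<Phi> s = (if t \<le> s then G s + \<delta> else G s)" for s
      by (simp add: \<Phi>_def G_def count \<delta>_def field_simps add_divide_distrib)
    have "t \<in> B \<longleftrightarrow> (\<forall>s\<ge>0. \<Phi> s \<le> \<Phi> t) \<and> (\<forall>s>t. \<Phi> s < \<Phi> t)"
    proof -
      have "stable_rank m x i = sl_count \<alpha> m x \<longleftrightarrow>
          (\<forall>s\<ge>0. \<Phi> s \<le> \<Phi> (x i)) \<and> (\<forall>s>x i. \<Phi> s < \<Phi> (x i))"
        unfolding \<Phi>_def
        by (rule stable_rank_eq_sl_count_iff) (use \<alpha> i nonneg t in \<open>auto simp: x_def\<close>)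
      then show ?thesis
        by (simp add: B_def x_def)
    qed
    also have "\<dots> \<longleftrightarrow> t \<in> A"
    proof
      assume *: "(\<forall>s\<ge>0. \<Phi> s \<le> \<Phi> t) \<and> (\<forall>s>t. \<Phi> s < \<Phi> t)"
      show "t \<in> A"
        unfolding A_def
      proof (intro CollectI conjI allI impI)
        show "G s \<le> G t + \<delta>" if "0 \<le> s" "s < t" for s
          using * that \<Phi>[of s] \<Phi>[of t] by auto
        show "G s < G t" if "t < s" for s
          using * that \<Phi>[of s] \<Phi>[of t] by auto
      qed (use t in simp)
    next
      assume "t \<in> A"
      then have lo: "\<And>s. 0 \<le> s \<Longrightarrow> s < t \<Longrightarrow> G s \<le> G t + \<delta>" and hi: "\<And>s. t < s \<Longrightarrow> G s < G t"
        by (auto simp: A_def)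
      have "\<Phi> s \<le> \<Phi> t" if "0 \<le> s" for s
        using lo[of s] hi[of s] that \<Phi>[of s] \<Phi>[of t] by (cases s t rule: linorder_cases) auto
      moreover have "\<Phi> s < \<Phi> t" if "t < s" for s
        using hi[of s] that \<Phi>[of s] \<Phi>[of t] by auto
      ultimately show "(\<forall>s\<ge>0. \<Phi> s \<le> \<Phi> t) \<and> (\<forall>s>t. \<Phi> s < \<Phi> t)"
        by blast
    qed
    finally show ?thesis .
  qed
  have "AE t in lborel. t \<notin> q ` {1..m}"
    by (intro AE_I'[of "q ` {1..m}"] finite_imp_null_set_lborel) auto
  then have "AE t in lborel. t \<in> {0..1} \<inter> B \<longleftrightarrow> t \<in> A"
  proof (rule AE_mp, intro AE_I2 impI)
    fix t :: real assume "t \<notin> q ` {1..m}"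
    then show "t \<in> {0..1} \<inter> B \<longleftrightarrow> t \<in> A"
      using B_iff[of t] A_le[of t] by (auto simp: A_def)
  qed
  then have "emeasure lborel ({0..1} \<inter> B) = emeasure lborel A"
    using B A_measure(1) by (intro emeasure_eq_AE) auto
  then show ?thesis
    using A_measure(2) by (simp add: \<delta>_def)
qed

section \<open>Measurability\<close>

lemma measurable_stable_rank:
  assumes [measurable]: "\<And>j. j \<in> {1..m} \<Longrightarrow> p j \<in> borel_measurable M" and i: "i \<in> {1..m}"
  shows "(\<lambda>\<omega>. stable_rank m (\<lambda>j. p j \<omega>) i) \<in> measurable M (count_space UNIV)"
  unfolding stable_rank_def
proof (rule measurable_card)
  have [measurable]: "p i \<in> borel_measurable M" using assms by blast
  fix j
  show "{\<omega> \<in> space M. j \<in> {j \<in> {1..m}. p j \<omega> < p i \<omega> \<or> p j \<omega> = p i \<omega> \<and> j \<le> i}} \<in> sets M"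
  proof (cases "j \<in> {1..m}")
    case True
    then have [measurable]: "p j \<in> borel_measurable M" using assms by blast
    show ?thesis using True by simp
  next
    case False
    then show ?thesis by (simp cong: conj_cong)
  qed
qed

lemma measurable_order_stat:
  assumes p: "\<And>j. j \<in> {1..m} \<Longrightarrow> p j \<in> borel_measurable M" and k: "k \<le> m"
  shows "(\<lambda>\<omega>. order_stat m (\<lambda>j. p j \<omega>) k) \<in> borel_measurable M"
proof (cases "k = 0")
  case False
  have count: "(\<lambda>\<omega>. count_upto m (\<lambda>j. p j \<omega>) s) \<in> measurable M (count_space UNIV)" for s
    unfolding count_upto_def
  proof (rule measurable_card)
    fix j
    show "{\<omega> \<in> space M. j \<in> {j \<in> {1..m}. p j \<omega> \<le> s}} \<in> sets M"
    proof (cases "j \<in> {1..m}")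
      case True
      then have [measurable]: "p j \<in> borel_measurable M" using p by blast
      show ?thesis using True by simp
    qed (simp cong: conj_cong)
  qed
  have "{\<omega> \<in> space M. k \<le> count_upto m (\<lambda>j. p j \<omega>) s} \<in> sets M" for s
    using measurable_sets[OF count, of "{k..}" s] by (simp add: vimage_def Int_def conj_commute)
  then show ?thesis
    using False k by (simp add: borel_measurable_iff_le order_stat_le_iff)
qed (simp add: order_stat_def)

lemma measurable_sl_count:
  assumes p: "\<And>j. j \<in> {1..m} \<Longrightarrow> p j \<in> borel_measurable M"
  shows "(\<lambda>\<omega>. sl_count \<alpha> m (\<lambda>j. p j \<omega>)) \<in> measurable M (count_space UNIV)"
  unfolding measurable_count_space_eq2_countable
proof (intro conjI ballI)
  fix k :: nat
  show "(\<lambda>\<omega>. sl_count \<alpha> m (\<lambda>j. p j \<omega>)) -` {k} \<inter> space M \<in> sets M"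
  proof (cases "k \<le> m")
    case True
    let ?f = "\<lambda>j \<omega>. \<alpha> * real j / real m - order_stat m (\<lambda>j. p j \<omega>) j"
    have f: "?f j \<in> borel_measurable M" if "j \<le> m" for j
      using measurable_order_stat[where p = p, OF p that] by simp
    have "{\<omega> \<in> space M. (\<forall>j\<in>{..m}. ?f j \<omega> \<le> ?f k \<omega>) \<and> (\<forall>j\<in>{k<..m}. ?f j \<omega> < ?f k \<omega>)} \<in> sets M"
      using f True
      by (intro sets.sets_Collect_conj sets.sets_Collect_finite_All' borel_measurable_le
          borel_measurable_less sets.sets_Collect_finite_All) auto
    then show ?thesis
      using sl_count_eq_iff[OF True, of \<alpha>] by (simp add: vimage_def Int_def conj_commute)
  next
    case False
    then have "(\<lambda>\<omega>. sl_count \<alpha> m (\<lambda>j. p j \<omega>)) -` {k} \<inter> space M = {}"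
      using sl_count_maximizer(1) by force
    then show ?thesis by simp
  qed
qed auto

lemma sets_rank_eq_sl_count:
  assumes "\<And>j. j \<in> {1..m} \<Longrightarrow> p j \<in> borel_measurable M" "i \<in> {1..m}"
  shows "{\<omega> \<in> space M. stable_rank m (\<lambda>j. p j \<omega>) i = sl_count \<alpha> m (\<lambda>j. p j \<omega>)} \<in> sets M"
proof -
  have [measurable]: "(\<lambda>\<omega>. stable_rank m (\<lambda>j. p j \<omega>) i) \<in> measurable M (count_space UNIV)"
    using assms by (rule measurable_stable_rank)
  have [measurable]: "(\<lambda>\<omega>. sl_count \<alpha> m (\<lambda>j. p j \<omega>)) \<in> measurable M (count_space UNIV)"
    using assms(1) by (rule measurable_sl_count)
  have "{\<omega> \<in> space M. real (stable_rank m (\<lambda>j. p j \<omega>) i) = real (sl_count \<alpha> m (\<lambda>j. p j \<omega>))}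
      \<in> sets M"
    by measurable
  then show ?thesis by simp
qed

section \<open>The boundary false discovery rate\<close>

lemma stable_rank_cong:
  assumes "\<And>j. j \<in> {1..m} \<Longrightarrow> q j = r j" "i \<in> {1..m}"
  shows "stable_rank m q i = stable_rank m r i"
  unfolding stable_rank_def by (rule arg_cong[where f = card]) (use assms in auto)

lemma sl_count_cong:
  assumes "\<And>j. j \<in> {1..m} \<Longrightarrow> q j = r j"
  shows "sl_count \<alpha> m q = sl_count \<alpha> m r"
proof -
  have "map q [1..<Suc m] = map r [1..<Suc m]"
    using assms by (intro map_cong) auto
  then have "order_stat m q = order_stat m r"
    unfolding order_stat_def by presburger
  then show ?thesis
    by (simp add: sl_count_def)
qed

text \<open>
  Independence makes the joint law of the p-values a product measure, in which the coordinate \<open>i\<close> can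
  be integrated first. The inner integral is the constant \<open>\<alpha> / m\<close> for almost all values of
  the others, namely the nonnegative ones.
\<close>

lemma (in prob_space) prob_null_at_boundary:
  fixes p :: "nat \<Rightarrow> 'a \<Rightarrow> real"
  assumes \<alpha>: "\<alpha> \<in> {0..1}" and i: "i \<in> {1..m}"
    and nonneg: "\<And>j \<omega>. j \<in> {1..m} \<Longrightarrow> \<omega> \<in> space M \<Longrightarrow> 0 \<le> p j \<omega>"
    and indep: "indep_vars (\<lambda>_. borel) p {1..m}"
    and unif: "distr M borel (p i) = uniform_measure lborel {0..1}"
  shows "prob {\<omega> \<in> space M. stable_rank m (\<lambda>j. p j \<omega>) i = sl_count \<alpha> m (\<lambda>j. p j \<omega>)} = \<alpha> / real m"
proof -
  have rv: "p j \<in> borel_measurable M" if "j \<in> {1..m}" for j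
    using indep that by (auto simp: indep_vars_def)
  \<comment> \<open>Outside \<open>{1..m}\<close> the factors only have to be probability measures.\<close>
  define D where "D j = (if j \<in> {1..m} then distr M borel (p j) else return borel 0)" for j
  have sets_D [measurable_cong]: "sets (D j) = sets borel" for j
    by (simp add: D_def)
  have D_prob: "prob_space (D j)" for j
    unfolding D_def using rv by (auto intro!: prob_space_distr prob_space_return)
  interpret D: product_prob_space D "{1..m} - {i}"
    using D_prob
    by (intro product_prob_space.intro product_prob_space_axioms.intro
        product_sigma_finite.intro prob_space_imp_sigma_finite) auto
  define J where "J = {1..m} - {i}"
  define P where "P = PiM {1..m} D"
  define E where "E = {q \<in> space P. stable_rank m q i = sl_count \<alpha> m q}"
  have ins: "insert i J = {1..m}" using i by (auto simp: J_def)
  have "(\<lambda>q. q j) \<in> borel_measurable P" if "j \<in> {1..m}" for j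
    unfolding P_def using that by measurable
  from sets_rank_eq_sl_count[where p = "\<lambda>j q. q j", OF this i, of \<alpha>]
  have E: "E \<in> sets P" by (simp add: E_def)

  have "distr M (PiM {1..m} (\<lambda>_. borel)) (\<lambda>\<omega>. \<lambda>j\<in>{1..m}. p j \<omega>)
      = PiM {1..m} (\<lambda>j. distr M borel (p j))"
    using indep_vars_iff_distr_eq_PiM'[where I = "{1..m}" and M' = "\<lambda>_. borel" and X = p] indep i rv by auto
  also have "\<dots> = P"
    unfolding P_def by (intro PiM_cong) (auto simp: D_def)
  finally have P: "P = distr M (PiM {1..m} (\<lambda>_. borel)) (\<lambda>\<omega>. \<lambda>j\<in>{1..m}. p j \<omega>)" ..
  have space_P: "space P = (\<Pi>\<^sub>E j\<in>{1..m}. UNIV)"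
    by (simp add: P space_PiM)
  have "emeasure P E = emeasure M ((\<lambda>\<omega>. \<lambda>j\<in>{1..m}. p j \<omega>) -` E \<inter> space M)"
    using E rv unfolding P by (subst emeasure_distr) (auto intro!: measurable_restrict)
  also have "(\<lambda>\<omega>. \<lambda>j\<in>{1..m}. p j \<omega>) -` E \<inter> space M =
      {\<omega> \<in> space M. stable_rank m (\<lambda>j. p j \<omega>) i = sl_count \<alpha> m (\<lambda>j. p j \<omega>)}"
    using stable_rank_cong[of m "\<lambda>j\<in>{1..m}. p j \<omega>" "\<lambda>j. p j \<omega>" i for \<omega>]
      sl_count_cong[of m "\<lambda>j\<in>{1..m}. p j \<omega>" "\<lambda>j. p j \<omega>" \<alpha> for \<omega>] i
    by (auto simp: E_def space_P)
  finally have prob_E: "emeasure M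
      {\<omega> \<in> space M. stable_rank m (\<lambda>j. p j \<omega>) i = sl_count \<alpha> m (\<lambda>j. p j \<omega>)} = emeasure P E" ..

  have slice: "(\<integral>\<^sup>+t. indicator E (q(i := t)) \<partial>D i) = ennreal (\<alpha> / real m)"
    if q: "q \<in> space (PiM J D)" and q_nonneg: "\<And>j. j \<in> J \<Longrightarrow> 0 \<le> q j" for q
  proof -
    define B where "B = {t. stable_rank m (q(i := t)) i = sl_count \<alpha> m (q(i := t))}"
    have upd: "q(i := t) \<in> space P" for t
      using q i by (auto simp: space_P space_PiM PiE_def J_def extensional_def)
    have "(\<lambda>t. (q(i := t)) j) \<in> borel_measurable borel" for j
      by (cases "j = i") auto
    from sets_rank_eq_sl_count[where p = "\<lambda>j t. (q(i := t)) j", OF this i, of \<alpha>]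
    have B: "B \<in> sets borel" by (simp add: B_def del: fun_upd_apply)
    have "(\<integral>\<^sup>+t. indicator E (q(i := t)) \<partial>D i) = (\<integral>\<^sup>+t. indicator B t \<partial>D i)"
      using upd by (intro nn_integral_cong) (auto simp: E_def B_def indicator_def)
    also have "\<dots> = emeasure (uniform_measure lborel {0..1}) B"
      using B i unif by (simp add: D_def)
    also have "\<dots> = emeasure lborel ({0..1} \<inter> B)"
      using B by (simp add: divide_ennreal_def)
    also have "\<dots> = ennreal (\<alpha> / real m)"
      unfolding B_def
      by (rule boundary_section_measure) (use \<alpha> i q_nonneg B in \<open>auto simp: J_def B_def\<close>)
    finally show ?thesis .
  qed

  have "AE q in PiM J D. \<forall>j\<in>J. 0 \<le> q j"
  proof (intro AE_finite_allI)
    fix j assume j: "j \<in> J"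
    then have j_in: "j \<in> {1..m}" by (simp add: J_def)
    have "AE x in distr M borel (p j). 0 \<le> x"
      using nonneg[OF j_in] rv[OF j_in] by (subst AE_distr_iff) auto
    then have "AE x in D j. 0 \<le> x"
      using j_in by (simp only: D_def if_True)
    then show "AE q in PiM J D. 0 \<le> q j"
      using AE_PiM_component[of J D j "\<lambda>x. 0 \<le> x"] D_prob j by blast
  qed (simp add: J_def)
  then have AE_slice: "AE q in PiM J D. (\<integral>\<^sup>+t. indicator E (q(i := t)) \<partial>D i) = ennreal (\<alpha> / real m)"
    by (rule AE_mp) (auto intro!: AE_I2 slice)
  have "emeasure P E = (\<integral>\<^sup>+q. indicator E q \<partial>P)"
    using E by simp
  also have "\<dots> = (\<integral>\<^sup>+q. (\<integral>\<^sup>+t. indicator E (q(i := t)) \<partial>D i) \<partial>PiM J D)"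
    unfolding P_def ins[symmetric]
  proof (rule D.product_nn_integral_insert)
    show "indicator E \<in> borel_measurable (PiM (insert i J) D)"
      using E by (simp only: P_def ins borel_measurable_indicator)
  qed (simp_all add: J_def)
  also have "\<dots> = (\<integral>\<^sup>+q. ennreal (\<alpha> / real m) \<partial>PiM J D)"
    using AE_slice by (rule nn_integral_cong_AE)
  also have "\<dots> = ennreal (\<alpha> / real m)"
    using prob_space.emeasure_space_1[OF prob_space_PiM[of J D]] D_prob by simp
  finally show ?thesis
    using prob_E \<alpha> by (simp add: measure_def)
qed

theorem theorem5p1:
  fixes M :: "'a measure" and m :: nat and \<alpha> :: real
    and p :: "nat \<Rightarrow> 'a \<Rightarrow> real" and H :: "nat \<Rightarrow> bool"
  assumes "prob_space M"
    and "m \<ge> 1"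
    and "\<alpha> \<in> {0..1}"
    and "\<And>i \<omega>. i \<in> {1..m} \<Longrightarrow> \<omega> \<in> space M \<Longrightarrow> p i \<omega> \<in> {0..1}"
    and "prob_space.indep_vars M (\<lambda>_. borel) p {1..m}"
    and "\<And>i. i \<in> {1..m} \<Longrightarrow> H i \<Longrightarrow> distr M borel (p i) = uniform_measure lborel {0..1}"
  shows "bFDR M m H p (sl_rejections \<alpha> m) = null_proportion m H * \<alpha>"
proof -
  interpret prob_space M by fact
  define I where "I = {i \<in> {1..m}. H i}"
  define Bd where
    "Bd i = {\<omega> \<in> space M. stable_rank m (\<lambda>j. p j \<omega>) i = sl_count \<alpha> m (\<lambda>j. p j \<omega>)}" for i
  have rv: "p j \<in> borel_measurable M" if "j \<in> {1..m}" for j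
    using assms(5) that by (auto simp: indep_vars_def)
  have at_boundary: "ordered_null m H q (sl_count \<alpha> m q) \<longleftrightarrow>
      (\<exists>i\<in>I. stable_rank m q i = sl_count \<alpha> m q)" for q
  proof (cases "sl_count \<alpha> m q = 0")
    case True
    then show ?thesis
      using stable_rank_bounds(1)[of _ m q] by (force simp: ordered_null_def I_def)
  next
    case False
    let ?k = "sl_count \<alpha> m q"
    have k: "1 \<le> ?k" "?k \<le> m"
      using False sl_count_maximizer(1)[of \<alpha> m q] by auto
    have "(\<exists>i\<in>I. stable_rank m q i = ?k) \<longleftrightarrow> (\<exists>i\<in>I. order_index m q ?k = i)"
      using order_index_eq_iff[OF _ k, of _ q] by (intro bex_cong) (auto simp: I_def)
    then show ?thesis
      using False order_index_range[OF k, of q] by (auto simp: ordered_null_def I_def)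
  qed
  have disjoint: "disjoint_family_on Bd I"
  proof -
    have "i = j" if "i \<in> I" "j \<in> I" "stable_rank m q i = stable_rank m q j" for i j q
    proof -
      have ij: "i \<in> {1..m}" "j \<in> {1..m}" using that by (auto simp: I_def)
      then show ?thesis
        using order_index_eq_iff[OF _ stable_rank_bounds[of i m q], of _ q] that(3) by metis
    qed
    then show ?thesis
      unfolding disjoint_family_on_def Bd_def by (auto 0 0) metis
  qed
  have "bFDR M m H p (sl_rejections \<alpha> m) =
      prob {\<omega> \<in> space M. ordered_null m H (\<lambda>i. p i \<omega>) (sl_count \<alpha> m (\<lambda>i. p i \<omega>))}"
    using assms(3) by (intro bFDR_sl_rejections) simp
  also have "\<dots> = prob (\<Union>i\<in>I. Bd i)"
    by (rule arg_cong[where f = prob]) (auto simp: at_boundary Bd_def)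
  also have "\<dots> = (\<Sum>i\<in>I. prob (Bd i))"
  proof (rule finite_measure_finite_Union[OF _ _ disjoint])
    show "Bd ` I \<subseteq> events"
      using sets_rank_eq_sl_count[where p = p and M = M and m = m and \<alpha> = \<alpha>, OF rv]
      by (auto simp: Bd_def I_def)
  qed (simp add: I_def)
  also have "\<dots> = (\<Sum>i\<in>I. \<alpha> / real m)"
  proof (intro sum.cong refl)
    fix i assume "i \<in> I"
    then show "prob (Bd i) = \<alpha> / real m"
      unfolding Bd_def using assms by (intro prob_null_at_boundary) (auto simp: I_def)
  qed
  also have "\<dots> = null_proportion m H * \<alpha>"
    by (simp add: null_proportion_def I_def)
  finally show ?thesis .
qed

end
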